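(* Let $t$ be a positive integer and $G$ a $K_{t,t}$-induced-minor-free graph. Then $\pi_4(G)\le t\cdot 2^t$.
   Context: $H$ is an induced minor of $G$ if there are pairwise disjoint vertex sets $\{X_v\}_{v\in V(H)}$ of $G$, each inducing a connected subgraph, with $uv\in E(H)$ iff some edge of $G$ joins $X_u$ and $X_v$; $K_{t,t}$ is the complete bipartite graph with sides of size $t$. A set $C\subseteq V(G)$ is $(1,r)$-coverable in $G$ if there is a vertex $v\in V(G)$ such that every vertex of $C$ has a path on at most $r$ vertices in $G$ to $v$. For $S\subseteq V(G)$, a partition $(X_1,\dots,X_\ell)$ of $S$ is an $r$-radius vertex partition of $S$ in $G$ if every connected component of every $G[X_i]$ is $(1,r)$-coverable in $G$; $\pi_r(S,G)$ is the least $\ell$ for which such a partition into $\ell$ parts exists, and $\pi_r(G):=\pi_r(V(G),G)$. *)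

theory Defs
  imports "Graph_Theory.Graph_Theory" "HOL-Library.Disjoint_Sets"
begin

text \<open>
  Finite simple graphs are those satisfying the locale predicate \<^const>\<open>graph\<close>, i.e. finite
  symmetric digraphs without loops and parallel arcs. Note that \<^const>\<open>connected\<close> excludes the
  null graph, so the sets of an induced minor model are nonempty.
\<close>

definition induced_minor :: "('c, 'd) pre_digraph \<Rightarrow> ('a, 'b) pre_digraph \<Rightarrow> bool" where
  "induced_minor H G \<longleftrightarrow> (\<exists>X.
     (\<forall>v\<in>verts H. X v \<subseteq> verts G \<and> connected (G \<restriction> X v)) \<and>
     disjoint_family_on X (verts H) \<and>
     (\<forall>u\<in>verts H. \<forall>v\<in>verts H. u \<noteq> v \<longrightarrow>
        (u \<rightarrow>\<^bsub>H\<^esub> v \<longleftrightarrow> (\<exists>x\<in>X u. \<exists>y\<in>X v. x \<rightarrow>\<^bsub>G\<^esub> y))))"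

text \<open>The length of a vertex path, as a list, is its number of vertices.\<close>

definition one_coverable :: "nat \<Rightarrow> ('a, 'b) pre_digraph \<Rightarrow> 'a set \<Rightarrow> bool" where
  "one_coverable r G C \<longleftrightarrow> C \<subseteq> verts G \<and>
     (\<exists>v\<in>verts G. \<forall>u\<in>C. \<exists>p. vpath p G \<and> hd p = u \<and> last p = v \<and> length p \<le> r)"

definition connected_component :: "('a, 'b) pre_digraph \<Rightarrow> ('a, 'b) pre_digraph \<Rightarrow> bool" where
  "connected_component C G \<longleftrightarrow> pre_digraph.max_subgraph G connected C"

text \<open>The components live in \<open>G \<restriction> X\<close>, but the covering paths may use all of \<open>G\<close>.\<close>

definition radius_vertex_partition ::
    "nat \<Rightarrow> 'a set \<Rightarrow> ('a, 'b) pre_digraph \<Rightarrow> 'a set set \<Rightarrow> bool" where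
  "radius_vertex_partition r S G P \<longleftrightarrow> partition_on S P \<and>
     (\<forall>X\<in>P. \<forall>C. connected_component C (G \<restriction> X) \<longrightarrow> one_coverable r G (verts C))"

definition radius_partition_number :: "nat \<Rightarrow> 'a set \<Rightarrow> ('a, 'b) pre_digraph \<Rightarrow> nat" where
  "radius_partition_number r S G =
     (LEAST l. \<exists>P. finite P \<and> card P = l \<and> radius_vertex_partition r S G P)"

abbreviation graph_radius_partition_number :: "nat \<Rightarrow> ('a, 'b) pre_digraph \<Rightarrow> nat" where
  "graph_radius_partition_number r G \<equiv> radius_partition_number r (verts G) G"

text \<open>The minimum above is over a nonempty set: the partition into singletons qualifies.\<close>

lemma radius_vertex_partition_exists:
  assumes "graph G" "S \<subseteq> verts G" "r \<ge> 1"
  shows "\<exists>P. finite P \<and> card P = card S \<and> radius_vertex_partition r S G P"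
proof -
  interpret graph G by fact
  let ?P = "(\<lambda>x. {x}) ` S"
  have fin: "finite S" using assms(2) by (rule finite_subset) simp
  have "one_coverable r G (verts C)"
    if x: "x \<in> S" and C: "connected_component C (G \<restriction> {x})" for x C
  proof -
    from C have "verts C \<subseteq> {x}"
      unfolding connected_component_def pre_digraph.max_subgraph_def
      by (auto dest!: subgraph_imp_subverts simp: induce_subgraph_verts)
    moreover have "vpath [x] G" using x assms(2) by (auto simp: vpath_def vwalk_def)
    ultimately show ?thesis using x assms(2,3) unfolding one_coverable_def
      by (intro conjI bexI[of _ x] ballI exI[of _ "[x]"]) auto
  qed
  moreover have "partition_on S ?P"
    by (auto simp: partition_on_def disjoint_def)
  ultimately have "radius_vertex_partition r S G ?P"
    unfolding radius_vertex_partition_def by auto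
  moreover have "card ?P = card S" by (rule card_image) (auto simp: inj_on_def)
  ultimately show ?thesis using fin by blast
qed

end

theory Submission
  imports Defs
begin

text \<open>
  Split a set \<open>S\<close> into the breadth-first layers of its components and colour by the parity of the
  layer: a connected monochromatic set lies in one layer \<open>s\<close>. If \<open>s \<le> 1\<close>, it is in a ball of radius
  1. Otherwise the layers up to \<open>s - 2\<close> form a connected set \<open>Y\<close> that is anticomplete to layer \<open>s\<close>,
  while every vertex of layer \<open>s\<close> has a neighbour, in layer \<open>s - 1\<close>, that is adjacent to \<open>Y\<close>.
  After \<open>t\<close> rounds, which cost a factor \<open>2\<close> each, there are \<open>t\<close> such sets \<open>Y\<close>, pairwise
  anticomplete because each lives in a layer of the previous rounds. If the remaining set has \<open>t\<close>
  vertices at pairwise distance at least \<open>4\<close>, then each of them together with its chosen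
  neighbours is a branch set, and these sets and the sets \<open>Y\<close> are the sides of an induced \<open>K\<^sub>t\<^sub>,\<^sub>t\<close>
  minor. Otherwise fewer than \<open>t\<close> balls of radius \<open>3\<close> cover the remaining set.
\<close>

section \<open>Connectivity and distance in a relation, and the invariant of the rounds\<close>

definition connected_in :: "'a rel \<Rightarrow> 'a set \<Rightarrow> bool" where
  "connected_in E W \<longleftrightarrow> W \<noteq> {} \<and> (\<forall>x\<in>W. \<forall>y\<in>W. (x, y) \<in> rtrancl_on W E)"

text \<open>Distance is counted in edges here, so radius 3 becomes 4 vertices in
  \<open>one_coverable\<close>.\<close>

definition near :: "'a rel \<Rightarrow> nat \<Rightarrow> 'a \<Rightarrow> 'a \<Rightarrow> bool" where
  "near E n x y \<longleftrightarrow> (\<exists>m\<le>n. (x, y) \<in> E ^^ m)"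

definition rel_dist :: "'a rel \<Rightarrow> 'a \<Rightarrow> 'a \<Rightarrow> nat" where
  "rel_dist R r x = (LEAST n. (r, x) \<in> R ^^ n)"

text \<open>\<open>F\<close> is the part built so far of one side of the minor, and \<open>S\<close>
  is a set still to be coloured. The witness \<open>z\<close> avoids \<open>S\<close> and all
  members of \<open>F\<close>, so that it can later join a branch set of the other side.\<close>

definition linked_family :: "'a rel \<Rightarrow> 'a set \<Rightarrow> 'a set set \<Rightarrow> 'a set \<Rightarrow> bool" where
  "linked_family E V F S \<longleftrightarrow>
     (\<forall>Y\<in>F. Y \<subseteq> V \<and> connected_in E Y \<and> Y \<inter> S = {} \<and> E \<inter> Y \<times> S = {}) \<and>
     (\<forall>Y\<in>F. \<forall>Z\<in>F. Y \<noteq> Z \<longrightarrow> Y \<inter> Z = {} \<and> E \<inter> Y \<times> Z = {}) \<and>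
     (\<forall>Y\<in>F. \<forall>x\<in>S. \<exists>z\<in>V - S - \<Union>F. (x, z) \<in> E \<and> (\<exists>y\<in>Y. (z, y) \<in> E))"

text \<open>A radius partition in terms of colours, so that palettes combine arithmetically.
  Quantifying over all connected sets, not just components, lets \<open>W\<close> be passed on to
  any layer that contains it. Balls are taken in all of \<open>E\<close>, not inside
  \<open>S\<close>.\<close>

definition ball_coloring :: "'a rel \<Rightarrow> 'a set \<Rightarrow> nat \<Rightarrow> 'a set \<Rightarrow> nat \<Rightarrow> ('a \<Rightarrow> nat) \<Rightarrow> bool" where
  "ball_coloring E V r S l c \<longleftrightarrow> c ` S \<subseteq> {..<l} \<and>
     (\<forall>W i. W \<subseteq> S \<longrightarrow> connected_in E W \<longrightarrow> c ` W \<subseteq> {i} \<longrightarrow> (\<exists>v\<in>V. \<forall>u\<in>W. near E r u v))"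

lemma near_refl [simp]: "near E n x x"
  unfolding near_def by (intro exI[of _ 0]) auto

lemma near_1: "near E 1 x y \<longleftrightarrow> x = y \<or> (x, y) \<in> E"
  unfolding near_def by (auto simp: le_Suc_eq)

lemma near_mono: "near E m x y \<Longrightarrow> m \<le> n \<Longrightarrow> near E n x y"
  unfolding near_def using le_trans by blast

lemma near_trans: "near E m x y \<Longrightarrow> near E n y z \<Longrightarrow> near E (m + n) x z"
  unfolding near_def by (metis add_mono relcomp.relcompI relpow_add)

lemma relpow_mono:
  fixes R E :: "'a rel"
  shows "R \<subseteq> E \<Longrightarrow> R ^^ n \<subseteq> E ^^ n"
  by (induction n) (simp_all add: relcomp_mono)

lemma relpow_sym: "sym E \<Longrightarrow> (x, y) \<in> E ^^ n \<Longrightarrow> (y, x) \<in> E ^^ n"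
proof (induction n arbitrary: y)
  case (Suc n)
  then obtain z where "(x, z) \<in> E ^^ n" "(z, y) \<in> E" by auto
  with Suc show ?case by (meson relpow_Suc_I2 symD)
qed simp

lemma near_sym: "sym E \<Longrightarrow> near E n x y \<Longrightarrow> near E n y x"
  unfolding near_def by (meson relpow_sym)

lemma rel_dist_relpow: "(r, x) \<in> R\<^sup>* \<Longrightarrow> (r, x) \<in> R ^^ rel_dist R r x"
  unfolding rel_dist_def by (rule LeastI_ex) (simp add: rtrancl_power)

lemma rel_dist_le: "(r, x) \<in> R ^^ n \<Longrightarrow> rel_dist R r x \<le> n"
  unfolding rel_dist_def by (rule Least_le)

lemma rel_dist_step: "(r, x) \<in> R\<^sup>* \<Longrightarrow> (x, y) \<in> R \<Longrightarrow> rel_dist R r y \<le> Suc (rel_dist R r x)"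
  by (rule rel_dist_le) (auto intro: rel_dist_relpow)

text \<open>Take the last but one vertex of a shortest walk. It is at distance at most
  \<open>n\<close> by this walk, and at least \<open>n\<close> because \<open>x\<close> is one step
  further.\<close>

lemma rel_dist_pred:
  assumes "(r, x) \<in> R\<^sup>*" "rel_dist R r x = Suc n"
  obtains y where "(r, y) \<in> R\<^sup>*" "(y, x) \<in> R" "rel_dist R r y = n"
proof -
  from rel_dist_relpow[OF assms(1)] assms(2)
  obtain y where y: "(r, y) \<in> R ^^ n" "(y, x) \<in> R" by auto
  then have r: "(r, y) \<in> R\<^sup>*" by (auto simp: rtrancl_power)
  with y assms show ?thesis
    using that rel_dist_le[OF y(1)] rel_dist_step[OF r y(2)] by simp
qed

lemma connected_in_if_reachable:
  assumes "sym E" "r \<in> W" "\<And>x. x \<in> W \<Longrightarrow> (r, x) \<in> rtrancl_on W E"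
  shows "connected_in E W"
  unfolding connected_in_def
  using assms rtrancl_on_sym[OF assms(1), of W] by (meson empty_iff rtrancl_on_trans symD)

text \<open>Used to turn a statement about single edges into the fact that a connected set lies in
  one layer of one component.\<close>

lemma connected_in_invariant:
  assumes "connected_in E W" "\<And>x y. x \<in> W \<Longrightarrow> y \<in> W \<Longrightarrow> (x, y) \<in> E \<Longrightarrow> f x = f y"
    "x \<in> W" "y \<in> W"
  shows "f x = f y"
proof -
  have "(x, y) \<in> rtrancl_on W E" using assms unfolding connected_in_def by blast
  then show ?thesis by (induction rule: rtrancl_on_induct) (auto dest: assms(2))
qed

text \<open>Going back along predecessors decreases the distance to \<open>r\<close>, so the walk
  found never leaves the set.\<close>

lemma connected_in_layers:
  assumes "sym E" "r \<in> S"
  defines "R \<equiv> Restr E S"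
  shows "connected_in E {x. (r, x) \<in> R\<^sup>* \<and> rel_dist R r x \<le> n}" (is "connected_in E ?Y")
proof (rule connected_in_if_reachable[OF assms(1)])
  have r0: "rel_dist R r r = 0" using rel_dist_le[where R = R and n = 0] by simp
  then show rY: "r \<in> ?Y" by simp
  fix x assume "x \<in> ?Y"
  then show "(r, x) \<in> rtrancl_on ?Y E"
  proof (induction "rel_dist R r x" arbitrary: x)
    case 0
    then have "x = r" using rel_dist_relpow[of r x R] by auto
    then show ?case using rY by auto
  next
    case (Suc k)
    then obtain y where y: "(r, y) \<in> R\<^sup>*" "(y, x) \<in> R" "rel_dist R r y = k"
      by (metis (lifting) mem_Collect_eq rel_dist_pred)
    then have "y \<in> ?Y" using Suc by auto
    with Suc(1)[of y] y have "(r, y) \<in> rtrancl_on ?Y E" by auto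
    then show ?case
      by (rule rtrancl_on_into_rtrancl_on) (use y Suc in \<open>auto simp: R_def\<close>)
  qed
qed

section \<open>Extending a linked family by breadth-first layers\<close>

lemma linked_familyD:
  assumes "linked_family E V F S" "Y \<in> F"
  shows "Y \<subseteq> V" "connected_in E Y" "Y \<inter> S = {}" "E \<inter> Y \<times> S = {}"
    and "Z \<in> F \<Longrightarrow> Y \<noteq> Z \<Longrightarrow> Y \<inter> Z = {}" "Z \<in> F \<Longrightarrow> Y \<noteq> Z \<Longrightarrow> E \<inter> Y \<times> Z = {}"
    and "x \<in> S \<Longrightarrow> \<exists>z\<in>V - S - \<Union>F. (x, z) \<in> E \<and> (\<exists>y\<in>Y. (z, y) \<in> E)"
  using assms by (simp_all add: linked_family_def)

text \<open>An edge raises the distance by at most 1, so none leads from \<open>Y\<close> to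
  \<open>L\<close>. The predecessor of a vertex of \<open>L\<close> lies in layer
  \<open>Suc n\<close>, thus outside both, and its own predecessor lies in \<open>Y\<close>.\<close>

lemma linked_family_layer:
  fixes n :: nat
  assumes "sym E" "S \<subseteq> V" "linked_family E V F S" "r \<in> S"
  defines "R \<equiv> Restr E S"
  defines "Y \<equiv> {x. (r, x) \<in> R\<^sup>* \<and> rel_dist R r x \<le> n}"
    and "L \<equiv> {x. (r, x) \<in> R\<^sup>* \<and> rel_dist R r x = Suc (Suc n)}"
  shows "linked_family E V (insert Y F) L" and "Y \<notin> F" and "L \<subseteq> S"
proof -
  have inS: "x \<in> S" if "(r, x) \<in> R\<^sup>*" for x
    using that assms(4) by (induction rule: rtrancl_induct) (auto simp: R_def)
  have YS: "Y \<subseteq> S" and LS: "L \<subseteq> S" by (auto simp: Y_def L_def inS)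
  show "L \<subseteq> S" by (fact LS)
  have conn: "connected_in E Y"
    unfolding Y_def R_def by (rule connected_in_layers) fact+
  have F: "Z \<subseteq> V" "connected_in E Z" "Z \<inter> S = {}" "E \<inter> Z \<times> S = {}" if "Z \<in> F" for Z
    by (fact linked_familyD[OF assms(3) that])+
  have F2: "Z \<inter> Z' = {}" "E \<inter> Z \<times> Z' = {}" if "Z \<in> F" "Z' \<in> F" "Z \<noteq> Z'" for Z Z'
    using linked_familyD(5,6)[OF assms(3)] that by blast+
  have F3: "\<exists>z\<in>V - S - \<Union>F. (x, z) \<in> E \<and> (\<exists>y\<in>Z. (z, y) \<in> E)" if "Z \<in> F" "x \<in> S" for Z x
    using linked_familyD(7)[OF assms(3)] that by blast
  \<comment> \<open>\<open>Y\<close> is a nonempty subset of \<open>S\<close>, which members of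
    \<open>F\<close> avoid. This makes the family grow in every round.\<close>
  show "Y \<notin> F" using F(3)[of Y] YS conn by (auto simp: connected_in_def)
  have YL: "Y \<inter> L = {}" by (auto simp: Y_def L_def)
  have EYL: "E \<inter> Y \<times> L = {}"
  proof -
    have False if "x \<in> Y" "y \<in> L" "(x, y) \<in> E" for x y
    proof -
      have "(x, y) \<in> R" using that YS LS by (auto simp: R_def)
      then have "rel_dist R r y \<le> Suc (rel_dist R r x)"
        using that by (intro rel_dist_step) (auto simp: Y_def)
      then show False using that by (auto simp: Y_def L_def)
    qed
    then show ?thesis by blast
  qed
  have dom: "\<exists>z\<in>V - L - \<Union>(insert Y F). (x, z) \<in> E \<and> (\<exists>y\<in>Y. (z, y) \<in> E)" if "x \<in> L" for x
  proof -
    from that obtain z where z: "(r, z) \<in> R\<^sup>*" "(z, x) \<in> R" "rel_dist R r z = Suc n"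
      unfolding L_def by (metis (lifting) mem_Collect_eq rel_dist_pred)
    then obtain y where y: "(r, y) \<in> R\<^sup>*" "(y, z) \<in> R" "rel_dist R r y = n"
      by (metis rel_dist_pred)
    have "z \<in> S" using z inS by blast
    then have "z \<in> V - L - \<Union>(insert Y F)"
      using z assms(2) F(3) by (auto simp: L_def Y_def)
    moreover have "y \<in> Y" using y by (simp add: Y_def)
    moreover have "(x, z) \<in> E" "(z, y) \<in> E"
      using z y assms(1) by (auto simp: R_def dest: symD)
    ultimately show ?thesis by blast
  qed
  \<comment> \<open>The old witnesses lie outside \<open>S\<close>, hence outside both
    \<open>Y\<close> and \<open>L\<close>, and still serve.\<close>
  have dom': "\<exists>z\<in>V - L - \<Union>(insert Y F). (x, z) \<in> E \<and> (\<exists>y\<in>Z. (z, y) \<in> E)"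
    if "x \<in> L" "Z \<in> F" for x Z
    using F3[of Z x] that LS YS by blast
  have EYF: "E \<inter> Y \<times> Z = {}" "E \<inter> Z \<times> Y = {}" "Y \<inter> Z = {}" "Z \<inter> Y = {}" if "Z \<in> F" for Z
    using F(3,4)[OF that] YS assms(1) by (blast dest: symD)+
  show "linked_family E V (insert Y F) L"
    unfolding linked_family_def
  proof (intro conjI)
    show "\<forall>Z\<in>insert Y F. Z \<subseteq> V \<and> connected_in E Z \<and> Z \<inter> L = {} \<and> E \<inter> Z \<times> L = {}"
    proof
      fix Z assume "Z \<in> insert Y F"
      then show "Z \<subseteq> V \<and> connected_in E Z \<and> Z \<inter> L = {} \<and> E \<inter> Z \<times> L = {}"
      proof
        assume "Z = Y"
        then show ?thesis using conn YS assms(2) YL EYL by auto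
      next
        assume Z: "Z \<in> F"
        moreover have "Z \<inter> L = {}" "E \<inter> Z \<times> L = {}" using F(3,4)[OF Z] LS by blast+
        ultimately show ?thesis using F(1,2) by simp
      qed
    qed
    show "\<forall>Z\<in>insert Y F. \<forall>Z'\<in>insert Y F. Z \<noteq> Z' \<longrightarrow> Z \<inter> Z' = {} \<and> E \<inter> Z \<times> Z' = {}"
      by (intro ballI impI, elim insertE) (simp_all add: F2 EYF)
    show "\<forall>Z\<in>insert Y F. \<forall>x\<in>L. \<exists>z\<in>V - L - \<Union>(insert Y F). (x, z) \<in> E \<and> (\<exists>y\<in>Z. (z, y) \<in> E)"
      by (intro ballI, elim insertE) (simp_all only: dom dom')
  qed
qed

section \<open>Colourings from layers and from centres\<close>

lemma ball_coloring_by_layers: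
  assumes "sym E" "S \<subseteq> V" "l > 0"
  defines "R \<equiv> Restr E S"
  assumes layers: "\<And>r n. r \<in> S \<Longrightarrow>
    \<exists>c. ball_coloring E V 3 {x. (r, x) \<in> R\<^sup>* \<and> rel_dist R r x = Suc (Suc n)} l c"
  shows "\<exists>c. ball_coloring E V 3 S (2 * l) c"
proof -
  have symR: "sym R" using assms(1) by (auto simp: R_def sym_def)
  define root where "root x = (SOME r. (r, x) \<in> R\<^sup>*)" for x
  have root: "(root x, x) \<in> R\<^sup>*" for x
    unfolding root_def by (rule someI[of _ x]) simp
  \<comment> \<open>As \<open>R\<close> is symmetric, the ends of an edge are reachable from the
    same vertices, so \<open>SOME\<close> picks the same root for both.\<close>
  have root_eq: "root x = root y" if "(x, y) \<in> R" for x y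
  proof -
    have "(r, x) \<in> R\<^sup>* \<longleftrightarrow> (r, y) \<in> R\<^sup>*" for r
      using that symR by (meson rtrancl.rtrancl_into_rtrancl symD)
    then show ?thesis unfolding root_def by simp
  qed
  have rootS: "root x \<in> S" if "x \<in> S" for x
    using root[of x] that by (induction rule: converse_rtrancl_induct) (auto simp: R_def)
  define d where "d x = rel_dist R (root x) x" for x
  define L where "L r n = {x. (r, x) \<in> R\<^sup>* \<and> rel_dist R r x = n}" for r n
  obtain c' where c': "\<And>r n. r \<in> S \<Longrightarrow> ball_coloring E V 3 (L r (Suc (Suc n))) l (c' r n)"
    using layers unfolding L_def by metis
  \<comment> \<open>The parity of the layer is \<open>c x mod 2\<close> and the colour inside the
    layer is \<open>c x div 2\<close>. Layers 0 and 1 need no inner colour and get the default 0, a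
    legal colour as \<open>l > 0\<close>.\<close>
  define c where
    "c x = 2 * (if d x \<le> 1 then 0 else c' (root x) (d x - 2) x) + d x mod 2" for x
  have inL: "x \<in> L (root x) (d x)" for x using root by (simp add: L_def d_def)
  have "ball_coloring E V 3 S (2 * l) c"
    unfolding ball_coloring_def
  proof (intro conjI allI impI)
    have "c x < 2 * l" if "x \<in> S" for x
    proof (cases "d x \<le> 1")
      case True
      then show ?thesis using assms(3) by (simp add: c_def)
    next
      case False
      then have "c' (root x) (d x - 2) x < l"
        using c'[OF rootS[OF that], of "d x - 2"] inL[of x]
        by (auto simp: ball_coloring_def Suc_diff_Suc numeral_2_eq_2)
      then show ?thesis using False by (simp add: c_def)
    qed
    then show "c ` S \<subseteq> {..<2 * l}" by auto
    fix W i assume W: "W \<subseteq> S" "connected_in E W" "c ` W \<subseteq> {i}"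
    \<comment> \<open>Distances of adjacent vertices differ by at most 1, and equal colours force
      equal parity.\<close>
    have step: "root x = root y \<and> d x = d y" if "x \<in> W" "y \<in> W" "(x, y) \<in> E" for x y
    proof -
      have xy: "(x, y) \<in> R" "(y, x) \<in> R" using that W(1) assms(1) by (auto simp: R_def dest: symD)
      have r: "root x = root y" using xy(1) by (rule root_eq)
      then have "d y \<le> Suc (d x)" "d x \<le> Suc (d y)"
        using rel_dist_step[OF root[of x] xy(1)] rel_dist_step[OF root[of y] xy(2)]
        by (auto simp: d_def)
      moreover have "d x mod 2 = d y mod 2"
      proof -
        have "c x = c y" using W(3) that by auto
        then have "c x mod 2 = c y mod 2" by simp
        then show ?thesis by (simp add: c_def)
      qed
      ultimately have "d x = d y" by presburger
      with r show ?thesis ..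
    qed
    obtain w where w: "w \<in> W" using W(2) by (auto simp: connected_in_def)
    have const: "root x = root w" "d x = d w" if "x \<in> W" for x
      using connected_in_invariant[OF W(2), of "\<lambda>x. (root x, d x)" x w] step that w by auto
    have wS: "root w \<in> S" using w W(1) rootS by blast
    show "\<exists>v\<in>V. \<forall>u\<in>W. near E 3 u v"
    proof (cases "d w \<le> 1")
      case True
      have "near E 3 u (root w)" if "u \<in> W" for u
      proof -
        have "(root w, u) \<in> R ^^ d w"
          using rel_dist_relpow[OF root[of u]] const[OF that] by (simp add: d_def)
        moreover have "R ^^ d w \<subseteq> E ^^ d w" by (rule relpow_mono) (auto simp: R_def)
        ultimately have "near E 1 (root w) u" using True unfolding near_def by blast
        then show ?thesis using near_sym[OF assms(1)] near_mono by (metis one_le_numeral)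
      qed
      then show ?thesis using wS assms(2) by blast
    next
      case False
      \<comment> \<open>The subtraction is exact since \<open>d w\<close> is at least 2 in this
        case.\<close>
      define n where "n = d w - 2"
      with False have n: "d w = Suc (Suc n)" by simp
      have "W \<subseteq> L (root w) (Suc (Suc n))"
      proof
        fix x assume "x \<in> W"
        then show "x \<in> L (root w) (Suc (Suc n))" using inL[of x] const[of x] n by simp
      qed
      moreover have "c' (root w) n ` W \<subseteq> {i div 2}"
      proof
        fix j assume "j \<in> c' (root w) n ` W"
        then obtain x where x: "x \<in> W" "j = c' (root w) n x" by blast
        then have "c x = 2 * j + d w mod 2" using const[of x] n by (simp add: c_def)
        moreover have "c x = i" using x W(3) by auto
        ultimately show "j \<in> {i div 2}" by simp
      qed
      ultimately show ?thesis
        using c'[OF wS, of n] W(2) unfolding ball_coloring_def by blast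
    qed
  qed
  then show ?thesis by blast
qed

text \<open>An inclusion-maximal set \<open>B\<close> of pairwise far vertices has fewer than
  \<open>t\<close> elements, and every vertex of \<open>S\<close> is near some element of
  \<open>B\<close>, as it could be added otherwise. Each vertex is coloured by the index of such a
  centre.\<close>

lemma ball_coloring_by_centers:
  assumes "finite S" "S \<subseteq> V" "sym E"
    and no_far: "\<not> (\<exists>B. B \<subseteq> S \<and> card B = t \<and> pairwise (\<lambda>x y. \<not> near E r x y) B)"
  shows "\<exists>c. ball_coloring E V r S t c"
proof -
  define far where "far B \<longleftrightarrow> B \<subseteq> S \<and> pairwise (\<lambda>x y. \<not> near E r x y) B" for B
  have "finite {B. far B}"
    by (rule finite_subset[of _ "Pow S"]) (use assms(1) in \<open>auto simp: far_def\<close>)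
  moreover have "{} \<in> {B. far B}" by (simp add: far_def)
  ultimately obtain B where B: "far B" and max: "\<And>B'. far B' \<Longrightarrow> B \<subseteq> B' \<Longrightarrow> B' = B"
    by (metis (lifting) finite_has_maximal2 mem_Collect_eq)
  have finB: "finite B" using B assms(1) finite_subset by (auto simp: far_def)
  have "card B < t"
  proof (rule ccontr)
    assume "\<not> card B < t"
    then obtain B' where "B' \<subseteq> B" "card B' = t" by (meson not_less obtain_subset_with_card_n)
    moreover from this have "B' \<subseteq> S" "pairwise (\<lambda>x y. \<not> near E r x y) B'"
      using B by (auto simp: far_def intro: pairwise_subset)
    ultimately show False using no_far by blast
  qed
  obtain f where f: "bij_betw f B {0..<card B}" using ex_bij_betw_finite_nat[OF finB] by blast
  have cover: "\<exists>b\<in>B. near E r x b" if "x \<in> S" for x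
  proof (rule ccontr)
    assume *: "\<not> (\<exists>b\<in>B. near E r x b)"
    then have "far (insert x B)"
      using B that near_sym[OF assms(3)] unfolding far_def by (auto simp: pairwise_insert)
    then have "x \<in> B" using max by blast
    then show False using * by auto
  qed
  then obtain b where b: "\<And>x. x \<in> S \<Longrightarrow> b x \<in> B \<and> near E r x (b x)" by metis
  have "ball_coloring E V r S t (f \<circ> b)"
    unfolding ball_coloring_def
  proof (intro conjI allI impI)
    have "f (b x) < card B" if "x \<in> S" for x using f b[OF that] by (auto simp: bij_betw_def)
    then show "(f \<circ> b) ` S \<subseteq> {..<t}" using \<open>card B < t\<close> by fastforce
    fix W i assume W: "W \<subseteq> S" "connected_in E W" "(f \<circ> b) ` W \<subseteq> {i}"
    obtain w where w: "w \<in> W" using W(2) by (auto simp: connected_in_def)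
    have "near E r u (b w)" if "u \<in> W" for u
    proof -
      have "f (b u) = f (b w)" using W(3) w that by auto
      then have "b u = b w" using f b W(1) w that unfolding bij_betw_def inj_on_def by blast
      then show ?thesis using b[of u] that W(1) by auto
    qed
    moreover have "b w \<in> V" using b[of w] w W(1) B assms(2) by (auto simp: far_def)
    ultimately show "\<exists>v\<in>V. \<forall>u\<in>W. near E r u v" by blast
  qed
  then show ?thesis by blast
qed

text \<open>Induction on the number \<open>k\<close> of rounds left. \<open>F\<close> and
  \<open>S\<close> are general because each root and each layer extends the family by a different
  set.\<close>

lemma ball_coloring_linked_family:
  assumes "finite V" "sym E" "t > 0"
    and no_minor: "\<And>F S B. linked_family E V F S \<Longrightarrow> finite F \<Longrightarrow> card F = t \<Longrightarrow> S \<subseteq> V \<Longrightarrow> B \<subseteq> S \<Longrightarrow>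
      card B = t \<Longrightarrow> pairwise (\<lambda>x y. \<not> near E 3 x y) B \<Longrightarrow> False"
  shows "linked_family E V F S \<Longrightarrow> finite F \<Longrightarrow> card F + k = t \<Longrightarrow> S \<subseteq> V \<Longrightarrow>
    \<exists>c. ball_coloring E V 3 S (t * 2 ^ k) c"
proof (induction k arbitrary: F S)
  case 0
  have "finite S" using 0 assms(1) finite_subset by blast
  \<comment> \<open>Now \<open>F\<close> has \<open>t\<close> members, so \<open>no_minor\<close>
    rules out \<open>t\<close> pairwise far vertices in \<open>S\<close>.\<close>
  then have "\<exists>c. ball_coloring E V 3 S t c"
    using 0 assms(2,3) no_minor[of F S] by (intro ball_coloring_by_centers) auto
  then show ?case by simp
next
  case (Suc k)
  have "\<exists>c. ball_coloring E V 3 S (2 * (t * 2 ^ k)) c"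
  proof (rule ball_coloring_by_layers)
    fix r n assume "r \<in> S"
    note L = linked_family_layer[OF assms(2) Suc.prems(4,1) this, of n]
    show "\<exists>c. ball_coloring E V 3
        {x. (r, x) \<in> (Restr E S)\<^sup>* \<and> rel_dist (Restr E S) r x = Suc (Suc n)} (t * 2 ^ k) c"
      by (rule Suc.IH[OF L(1)]) (use L Suc.prems in auto)
  qed (use Suc.prems assms in auto)
  then show ?case by (simp add: mult.left_commute)
qed

section \<open>Translation between digraphs and relations\<close>

lemma (in graph) connected_induce_iff:
  "connected (G \<restriction> W) \<longleftrightarrow> connected_in (arcs_ends G) W"
proof -
  have "parcs (mk_symmetric (G \<restriction> W)) = Restr (arcs_ends G) W"
    using sym_arcs
    by (auto simp: parcs_mk_symmetric arcs_ends_conv symmetric_def sym_def)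
  moreover have "(x, y) \<in> rtrancl_on W (Restr (arcs_ends G) W) \<longleftrightarrow> (x, y) \<in> rtrancl_on W (arcs_ends G)"
    (is "?l \<longleftrightarrow> ?r") for x y
  proof
    show ?r if ?l using that by (rule rtrancl_on_mono[rotated 2]) auto
    show ?l if ?r using that
      by (induction rule: rtrancl_on_induct) (auto intro: rtrancl_on_into_rtrancl_on)
  qed
  ultimately show ?thesis
    by (simp add: connected_def strongly_connected_def reachable_def connected_in_def)
qed

lemma length_vwalk_to_vpath_le: "length (vwalk_to_vpath p) \<le> length p"
  by (induction p rule: vwalk_to_vpath_induct3)
    (auto intro: le_SucI order_trans[OF _ length_dropWhile_le])

lemma (in wf_digraph) relpow_arcs_ends_imp_vwalk:
  assumes "u \<in> verts G" "(u, v) \<in> arcs_ends G ^^ n"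
  shows "\<exists>p. vwalk p G \<and> hd p = u \<and> last p = v \<and> length p = Suc n"
  using assms
proof (induction n arbitrary: u)
  case 0
  then show ?case by (intro exI[of _ "[u]"]) auto
next
  case (Suc n)
  then obtain w where w: "(u, w) \<in> arcs_ends G" "(w, v) \<in> arcs_ends G ^^ n"
    by (meson relpow_Suc_D2)
  with Suc.IH[of w] obtain p where p: "vwalk p G" "hd p = w" "last p = v" "length p = Suc n"
    using adj_in_verts by blast
  then show ?case using w
    by (intro exI[of _ "u # p"]) (auto intro: vwalk_wf_digraph_consI)
qed

text \<open>A walk with at most \<open>n\<close> arcs has at most \<open>Suc n\<close> vertices, and
  shortcutting it to a path does not lengthen it.\<close>

lemma (in wf_digraph) near_imp_vpath:
  assumes "u \<in> verts G" "near (arcs_ends G) n u v"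
  shows "\<exists>p. vpath p G \<and> hd p = u \<and> last p = v \<and> length p \<le> Suc n"
proof -
  from assms(2) obtain m where "m \<le> n" "(u, v) \<in> arcs_ends G ^^ m" by (auto simp: near_def)
  moreover from this assms(1) obtain p where "vwalk p G" "hd p = u" "last p = v" "length p = Suc m"
    using relpow_arcs_ends_imp_vwalk by blast
  ultimately show ?thesis
    using length_vwalk_to_vpath_le[of p]
    by (intro exI[of _ "vwalk_to_vpath p"])
      (auto simp: vwalk_to_vpath_vpath vwalk_to_vpath_hd vwalk_to_vpath_last)
qed

lemma (in graph) induced_minor_of_linked_family:
  assumes K: "complete_bipartite_digraph t t K"
    and lf: "linked_family (arcs_ends G) (verts G) F S" and F: "finite F" "card F = t"
    and S: "S \<subseteq> verts G" and B: "B \<subseteq> S" "card B = t"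
    and far: "pairwise (\<lambda>x y. \<not> near (arcs_ends G) 3 x y) B"
  shows "induced_minor K G"
proof -
  let ?E = "arcs_ends G"
  have symE: "sym ?E" using sym_arcs by (simp add: symmetric_def)
  from K obtain U W where UW: "verts K = U \<union> W" "U \<inter> W = {}" "card U = t" "card W = t"
    and EK: "arcs_ends K = U \<times> W \<union> W \<times> U" and "graph K"
    unfolding complete_bipartite_digraph_def by blast
  interpret K: graph K by fact
  have "finite U" "finite W" using K.finite_verts UW(1) by auto
  moreover have "finite B" using B(1) S by (meson finite_subset finite_verts)
  ultimately obtain f g where f: "bij_betw f U F" and g: "bij_betw g W B"
    using F B(2) UW(3,4) by (metis finite_same_card_bij)
  have fF: "f u \<in> F" if "u \<in> U" for u using f that by (auto simp: bij_betw_def)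
  have f_neq: "f u \<noteq> f v" if "u \<in> U" "v \<in> U" "u \<noteq> v" for u v
    using f that by (auto simp: bij_betw_def inj_on_def)
  have gB: "g w \<in> B" if "w \<in> W" for w using g that by (auto simp: bij_betw_def)
  have g_neq: "g u \<noteq> g v" if "u \<in> W" "v \<in> W" "u \<noteq> v" for u v
    using g that by (auto simp: bij_betw_def inj_on_def)
  have Y: "Y \<subseteq> verts G" "connected_in ?E Y" "Y \<inter> S = {}" if "Y \<in> F" for Y
    by (fact linked_familyD[OF lf that])+
  have YZ: "Y \<inter> Z = {}" "?E \<inter> Y \<times> Z = {}" if "Y \<in> F" "Z \<in> F" "Y \<noteq> Z" for Y Z
    using linked_familyD(5,6)[OF lf] that by blast+
  have "\<exists>z\<in>verts G - S - \<Union>F. (b, z) \<in> ?E \<and> (\<exists>y\<in>Y. (z, y) \<in> ?E)" if "Y \<in> F" "b \<in> S" for Y b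
    using linked_familyD(7)[OF lf] that by blast
  then obtain z where z: "\<And>Y b. Y \<in> F \<Longrightarrow> b \<in> S \<Longrightarrow>
      z Y b \<in> verts G - S - \<Union>F \<and> (b, z Y b) \<in> ?E \<and> (\<exists>y\<in>Y. (z Y b, y) \<in> ?E)"
    by metis
  \<comment> \<open>A star: the centre \<open>b\<close> with one link vertex towards each member of
    \<open>F\<close>.\<close>
  define T where "T b = insert b ((\<lambda>Y. z Y b) ` F)" for b
  have T_verts: "T b \<subseteq> verts G" and T_disj: "Y \<in> F \<Longrightarrow> T b \<inter> Y = {}" if "b \<in> B" for b Y
    using z[of _ b] that B(1) S Y(3)[of Y] by (auto simp: T_def)
  have T_near: "near ?E 1 b p" if "b \<in> B" "p \<in> T b" for b p
    unfolding near_1 using z[of _ b] that B(1) by (auto simp: T_def)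
  have T_conn: "connected_in ?E (T b)" if "b \<in> B" for b
  proof (rule connected_in_if_reachable[OF symE])
    show b: "b \<in> T b" by (simp add: T_def)
    fix p assume p: "p \<in> T b"
    have "(b, b) \<in> rtrancl_on (T b) ?E" using b by auto
    then show "(b, p) \<in> rtrancl_on (T b) ?E"
      using T_near[OF that p] p unfolding near_1 by (auto intro: rtrancl_on_into_rtrancl_on)
  qed
  \<comment> \<open>Centre to \<open>p\<close>, \<open>p\<close> to \<open>q\<close>, and
    \<open>q\<close> to centre cost one step each, which is where distance 3 comes from. As
    \<open>near\<close> with bound 1 includes equality, this gives both disjointness and the absence
    of edges.\<close>
  have T_far: "\<not> near ?E 1 p q" if "b \<in> B" "b' \<in> B" "b \<noteq> b'" "p \<in> T b" "q \<in> T b'" for b b' p q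
  proof
    assume "near ?E 1 p q"
    with T_near[of b p] T_near[of b' q] that have "near ?E (1 + 1 + 1) b b'"
      by (meson near_trans near_sym symE)
    then show False using far that by (auto simp: pairwise_def numeral_3_eq_3)
  qed
  \<comment> \<open>Both orientations are kept because \<open>induced_minor\<close> compares ordered
    pairs.\<close>
  have T_adj: "\<exists>p\<in>T b. \<exists>y\<in>Y. (p, y) \<in> ?E \<and> (y, p) \<in> ?E" if "b \<in> B" "Y \<in> F" for b Y
    using z[of Y b] that B(1) symE unfolding T_def by (blast dest: symD)
  define X where "X v = (if v \<in> U then f v else T (g v))" for v
  have XU: "X v = f v" if "v \<in> U" for v using that by (simp add: X_def)
  have XW: "X v = T (g v)" if "v \<in> W" for v using that UW(2) by (auto simp: X_def)
  show ?thesis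
    unfolding induced_minor_def
  proof (intro exI[of _ X] conjI ballI impI)
    fix v assume "v \<in> verts K"
    then consider "v \<in> U" | "v \<in> W" using UW(1) by blast
    then show "X v \<subseteq> verts G" "connected (G \<restriction> X v)"
      by (cases; use Y fF gB T_verts T_conn in \<open>simp add: XU XW connected_induce_iff\<close>)+
  next
    show "disjoint_family_on X (verts K)"
      unfolding disjoint_family_on_def
    proof (intro ballI impI)
      fix u v assume uv: "u \<in> verts K" "v \<in> verts K" "u \<noteq> v"
      then consider "u \<in> U" "v \<in> U" | "u \<in> U" "v \<in> W" | "u \<in> W" "v \<in> U" | "u \<in> W" "v \<in> W"
        using UW(1) by blast
      then show "X u \<inter> X v = {}"
      proof cases
        case 1
        then show ?thesis using YZ(1)[OF fF fF f_neq] uv(3) by (simp add: XU)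
      next
        case 2
        then show ?thesis using T_disj[OF gB fF, of v u] by (simp add: XU XW Int_commute)
      next
        case 3
        then show ?thesis using T_disj[OF gB fF, of u v] by (simp add: XU XW)
      next
        case 4
        then show ?thesis
          using T_far[OF gB gB g_neq, of u v] uv(3) near_refl[of ?E 1] by (simp only: XW) blast
      qed
    qed
  next
    fix u v assume uv: "u \<in> verts K" "v \<in> verts K" "u \<noteq> v"
    then consider "u \<in> U" "v \<in> U" | "u \<in> U" "v \<in> W" | "u \<in> W" "v \<in> U" | "u \<in> W" "v \<in> W"
      using UW(1) by blast
    then show "u \<rightarrow>\<^bsub>K\<^esub> v \<longleftrightarrow> (\<exists>x\<in>X u. \<exists>y\<in>X v. x \<rightarrow>\<^bsub>G\<^esub> y)"
    proof cases
      case 1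
      then have "\<not> u \<rightarrow>\<^bsub>K\<^esub> v" using EK UW(2) by blast
      then show ?thesis using 1 YZ(2)[OF fF fF f_neq, of u v] uv(3) by (auto simp: XU)
    next
      case 2
      then have "u \<rightarrow>\<^bsub>K\<^esub> v" using EK by blast
      then show ?thesis using 2 T_adj[OF gB fF, of v u] by (auto simp: XU XW)
    next
      case 3
      then have "u \<rightarrow>\<^bsub>K\<^esub> v" using EK by blast
      then show ?thesis using 3 T_adj[OF gB fF, of u v] by (auto simp: XU XW)
    next
      case 4
      then have "\<not> u \<rightarrow>\<^bsub>K\<^esub> v" using EK UW(2) by blast
      then show ?thesis
        using 4 T_far[OF gB gB g_neq, of u v, unfolded near_1] uv(3) by (auto simp: XW)
    qed
  qed
qed

text \<open>The colour classes are the parts: a component of a class is a connected monochromatic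
  set and so lies in one ball.\<close>

lemma (in graph) radius_partition_number_le_if_ball_coloring:
  assumes c: "ball_coloring (arcs_ends G) (verts G) r S l c" and S: "S \<subseteq> verts G"
  shows "radius_partition_number (Suc r) S G \<le> l"
proof -
  \<comment> \<open>Only colours that occur are used, since a partition has no empty part.\<close>
  define P where "P = (\<lambda>i. {x \<in> S. c x = i}) ` c ` S"
  have cS: "c ` S \<subseteq> {..<l}" using c by (simp add: ball_coloring_def)
  then have fin: "finite (c ` S)" using finite_subset by blast
  have "card P \<le> card (c ` S)" unfolding P_def by (rule card_image_le[OF fin])
  also have "\<dots> \<le> l" using card_mono[OF _ cS] by simp
  finally have card: "card P \<le> l" .
  have "one_coverable (Suc r) G (verts C)"
    if "X \<in> P" and C: "connected_component C (G \<restriction> X)" for X C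
  proof -
    from that(1) obtain i where X: "X = {x \<in> S. c x = i}" unfolding P_def by blast
    have sub: "subgraph C (G \<restriction> X)" and conn: "connected C"
      using C unfolding connected_component_def pre_digraph.max_subgraph_def by auto
    have CX: "verts C \<subseteq> X" using subgraph_imp_subverts[OF sub] by simp
    have "arcs_ends C \<subseteq> arcs_ends G"
      using arcs_ends_mono[OF sub] by (auto simp: arcs_ends_conv)
    \<comment> \<open>\<open>connected\<close> speaks of walks in the symmetric closure, which stays
      within the edges of the symmetric digraph \<open>G\<close>.\<close>
    then have "(arcs_ends C)\<^sup>s \<subseteq> arcs_ends G"
      using sym_arcs by (auto simp: symcl_def symmetric_def dest: symD)
    then have "connected_in (arcs_ends G) (verts C)"
      using conn unfolding connected_conv connected_in_def
      by (blast intro: rtrancl_on_mono[OF _ subset_refl])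
    then obtain v where v: "v \<in> verts G" "\<forall>u\<in>verts C. near (arcs_ends G) r u v"
      using c[unfolded ball_coloring_def, THEN conjunct2, rule_format, of "verts C" i] CX X
      by blast
    then show ?thesis
      unfolding one_coverable_def using CX X S near_imp_vpath by blast
  qed
  moreover have "partition_on S P"
    by (auto simp: P_def partition_on_def disjoint_def)
  ultimately have "radius_vertex_partition (Suc r) S G P"
    unfolding radius_vertex_partition_def by blast
  then have "radius_partition_number (Suc r) S G \<le> card P"
    unfolding radius_partition_number_def using fin by (intro Least_le) (auto simp: P_def)
  with card show ?thesis by simp
qed

theorem theorem9p1:
  fixes t :: nat and G :: "('a, 'b) pre_digraph" and K :: "('c, 'd) pre_digraph"
  assumes "t > 0"
    and "graph G"
    and "complete_bipartite_digraph t t K"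
    and "\<not> induced_minor K G"
  shows "graph_radius_partition_number 4 G \<le> t * 2 ^ t"
proof -
  interpret graph G by fact
  let ?E = "arcs_ends G" and ?V = "verts G"
  have "sym ?E" using sym_arcs by (simp add: symmetric_def)
  \<comment> \<open>The start is the empty family with all vertices left to colour and all
    \<open>t\<close> rounds to go.\<close>
  moreover have "linked_family ?E ?V {} ?V" by (simp add: linked_family_def)
  ultimately have "\<exists>c. ball_coloring ?E ?V 3 ?V (t * 2 ^ t) c"
    using assms induced_minor_of_linked_family[OF assms(3)]
    by (intro ball_coloring_linked_family[where F = "{}"]) simp_all
  then show ?thesis
    using radius_partition_number_le_if_ball_coloring[of 3 ?V] by auto
qed

end
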